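(* Let $n=8$ and consider the square board of $(n+1)\times(n+1)=9\times 9$ cells. The number of equivalence classes of closed knight paths of length $8$ on this board is exactly $478$.
   Context: Cells of an $m\times m$ board are identified with pairs $(i,j)\in\{1,\dots,m\}^2$. Two cells $(i,j),(i',j')$ are a knight's move apart if $\{|i-i'|,|j-j'|\}=\{1,2\}$. A closed knight path of length $n$ on the board is a set of $n$ distinct cells that can be listed as $c_1,\dots,c_n$ so that $c_k$ and $c_{k+1}$ are a knight's move apart for $k=1,\dots,n-1$, and $c_n$ and $c_1$ are a knight's move apart (i.e. the set can be traversed by a closed knight path visiting each of its cells exactly once). Two such sets are equivalent if one can be obtained from the other by a finite sequence of the following transformations, each keeping all cells on the board: translation (shifting every cell by one step up, down, left or right), rotation of the board by $90^\circ$, and reflection of the board (these rotations and reflections generate the dihedral group of order 8 of symmetries of the square board). *)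

theory Defs
  imports Main
begin

type_synonym cell = "int \<times> int"

definition board :: "nat \<Rightarrow> cell set" where
  "board m = {1..int m} \<times> {1..int m}"

definition knight_move :: "cell \<Rightarrow> cell \<Rightarrow> bool" where
  "knight_move c d \<longleftrightarrow> {\<bar>fst c - fst d\<bar>, \<bar>snd c - snd d\<bar>} = {1, 2}"

text \<open>A closed knight path is the set of visited cells: two different closed tours through the
  same cells are the same closed knight path.\<close>

definition closed_knight_paths :: "nat \<Rightarrow> nat \<Rightarrow> cell set set" where
  "closed_knight_paths m n =
     {S. S \<subseteq> board m \<and>
         (\<exists>c :: nat \<Rightarrow> cell. S = c ` {1..n} \<and> inj_on c {1..n} \<and>
            (\<forall>k\<in>{1..<n}. knight_move (c k) (c (k + 1))) \<and> knight_move (c n) (c 1))}"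

definition unit_shifts :: "(cell \<Rightarrow> cell) set" where
  "unit_shifts =
     {\<lambda>(i, j). (i + 1, j), \<lambda>(i, j). (i - 1, j), \<lambda>(i, j). (i, j + 1), \<lambda>(i, j). (i, j - 1)}"

definition board_rotations :: "nat \<Rightarrow> (cell \<Rightarrow> cell) set" where
  "board_rotations m = {\<lambda>(i, j). (j, int m + 1 - i), \<lambda>(i, j). (int m + 1 - j, i)}"

definition board_reflections :: "nat \<Rightarrow> (cell \<Rightarrow> cell) set" where
  "board_reflections m =
     {\<lambda>(i, j). (int m + 1 - i, j), \<lambda>(i, j). (i, int m + 1 - j),
      \<lambda>(i, j). (j, i), \<lambda>(i, j). (int m + 1 - j, int m + 1 - i)}"

definition elementary_step :: "nat \<Rightarrow> (cell set \<times> cell set) set" where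
  "elementary_step m =
     {(S, T). S \<subseteq> board m \<and> T \<subseteq> board m \<and>
        (\<exists>f \<in> unit_shifts \<union> board_rotations m \<union> board_reflections m. T = f ` S)}"

definition path_equiv :: "nat \<Rightarrow> nat \<Rightarrow> (cell set \<times> cell set) set" where
  "path_equiv m n =
     (elementary_step m)\<^sup>* \<inter> closed_knight_paths m n \<times> closed_knight_paths m n"

lemma elementary_step_converse:
  assumes "(S, T) \<in> elementary_step m"
  shows "(T, S) \<in> elementary_step m"
proof -
  let ?F = "unit_shifts \<union> board_rotations m \<union> board_reflections m"
  from assms obtain f where ST: "S \<subseteq> board m" "T \<subseteq> board m" "T = f ` S" and f: "f \<in> ?F"
    unfolding elementary_step_def by blast
  have "\<exists>g\<in>?F. \<forall>c. g (f c) = c"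
    using f unfolding unit_shifts_def board_rotations_def board_reflections_def
    by (elim UnE insertE emptyE; simp)
  then obtain g where g: "g \<in> ?F" "\<And>c. g (f c) = c" by blast
  then have "S = g ` T" using ST(3) by (simp add: image_image)
  with ST g(1) show ?thesis unfolding elementary_step_def by blast
qed

lemma equiv_path_equiv: "equiv (closed_knight_paths m n) (path_equiv m n)"
proof -
  have "sym (elementary_step m)"
    by (rule symI) (rule elementary_step_converse)
  then have "sym ((elementary_step m)\<^sup>*)" by (rule sym_rtrancl)
  then show ?thesis
    unfolding equiv_def path_equiv_def refl_on_def sym_def trans_def
    by (auto intro: rtrancl_trans)
qed

end

theory Submission
  imports Defs "HOL-Library.Product_Lexorder" "HOL-Library.List_Lexorder" "HOL-Library.Product_Plus"
begin

text \<open>A closed knight path with \<open>n\<close> moves spans at most \<open>n + 1\<close> rows and columns, because one of the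
  two arcs between any two of its cells has at most \<open>n / 2\<close> moves. Hence every closed path of length
  \<open>n\<close> in the plane has a translate on the board of size \<open>n + 1\<close>, and two paths on the board are
  equivalent iff some translation composed with an element of the dihedral group of the lattice maps
  one to the other. Moving the lexicographically least cell to the origin, sorting, and
  minimising over the eight symmetries yields a complete invariant. Its values are the cell sets
  of the cycles that start at the origin, stay lexicographically above it, and are not larger than
  any of their eight normalised images; a depth-first search with pruning lists these sets.\<close>

section \<open>A complete invariant for the equivalence\<close>

lemma card_quotient_eq_card_image:
  assumes "equiv X R" and "\<And>x y. x \<in> X \<Longrightarrow> y \<in> X \<Longrightarrow> (x, y) \<in> R \<longleftrightarrow> f x = f y"
  shows "card (X // R) = card (f ` X)"
proof -
  have R: "(x, y) \<in> R \<longleftrightarrow> x \<in> X \<and> y \<in> X \<and> f x = f y" for x y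
    using assms(2) equiv_type[OF assms(1)] by blast
  define h where "h v = {x \<in> X. f x = v}" for v
  have "R `` {x} = h (f x)" if "x \<in> X" for x
    using that by (auto simp: h_def R)
  then have "X // R = h ` (f ` X)"
    by (auto simp: quotient_def)
  moreover have "inj_on h (f ` X)"
    by (auto simp: inj_on_def h_def)
  ultimately show ?thesis
    by (simp add: card_image)
qed

section \<open>Translations and the lexicographic order on cells\<close>

lemma strict_mono_add_cell: "strict_mono ((+) (v :: cell))"
  by (rule strict_monoI) (auto simp: less_prod_def)

lemma Min_translate:
  fixes S :: "cell set"
  assumes "finite S" "S \<noteq> {}"
  shows "Min ((+) v ` S) = v + Min S"
  using mono_Min_commute[OF strict_mono_mono[OF strict_mono_add_cell] assms] by metis

definition normal_form :: "cell set \<Rightarrow> cell set" where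
  "normal_form S = (+) (- Min S) ` S"

lemma normal_form_translate:
  assumes "finite S" "S \<noteq> {}"
  shows "normal_form ((+) v ` S) = normal_form S"
  unfolding normal_form_def Min_translate[OF assms] image_image by simp

lemma Min_normal_form:
  assumes "finite S" "S \<noteq> {}"
  shows "Min (normal_form S) = 0"
  unfolding normal_form_def Min_translate[OF assms] by simp

section \<open>The dihedral group of the lattice\<close>

text \<open>For signs \<open>a\<close> and \<open>b\<close> these are the signed permutation
  matrices, the linear parts of the board symmetries; the signs act after the swap.\<close>

definition signed_perm :: "bool \<Rightarrow> int \<Rightarrow> int \<Rightarrow> cell \<Rightarrow> cell" where
  "signed_perm t a b = (\<lambda>(i, j). if t then (a * j, b * i) else (a * i, b * j))"

definition dihedral :: "(cell \<Rightarrow> cell) set" where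
  "dihedral = {signed_perm t a b | t a b. a \<in> {1, -1} \<and> b \<in> {1, -1}}"

lemma signed_perm_add: "signed_perm t a b (u + v) = signed_perm t a b u + signed_perm t a b v"
  by (cases u; cases v) (simp add: signed_perm_def algebra_simps)

lemma signed_perm_comp:
  "signed_perm t a b \<circ> signed_perm t' a' b' =
     signed_perm (t \<noteq> t') (a * (if t then b' else a')) (b * (if t then a' else b'))"
  by (auto simp: signed_perm_def fun_eq_iff)

lemma dihedral_add: "g \<in> dihedral \<Longrightarrow> g (u + v) = g u + g v"
  by (auto simp: dihedral_def signed_perm_add)

lemma id_in_dihedral: "id \<in> dihedral"
proof -
  have "id = signed_perm False 1 1" by (auto simp: signed_perm_def fun_eq_iff)
  then show ?thesis unfolding dihedral_def by blast
qed

lemma dihedral_comp: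
  assumes "g \<in> dihedral" "h \<in> dihedral"
  shows "g \<circ> h \<in> dihedral"
proof -
  obtain t a b t' a' b' where "g = signed_perm t a b" "a \<in> {1, -1}" "b \<in> {1, -1}"
    "h = signed_perm t' a' b'" "a' \<in> {1, -1}" "b' \<in> {1, -1}"
    using assms unfolding dihedral_def by blast
  moreover from this have "a * (if t then b' else a') \<in> {1, -1}" "b * (if t then a' else b') \<in> {1, -1}"
    by auto
  ultimately show ?thesis
    unfolding dihedral_def mem_Collect_eq using signed_perm_comp by blast
qed

lemma dihedral_inverse:
  assumes "g \<in> dihedral"
  obtains h where "h \<in> dihedral" "h \<circ> g = id" "g \<circ> h = id"
proof -
  from assms obtain t a b where g: "g = signed_perm t a b" "a \<in> {1, -1}" "b \<in> {1, -1}"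
    by (auto simp: dihedral_def)
  \<comment> \<open>Each sign is its own inverse, and pulling the signs through a swap exchanges
    them.\<close>
  let ?h = "signed_perm t (if t then b else a) (if t then a else b)"
  have "?h \<in> dihedral" using g unfolding dihedral_def by force
  moreover have "?h \<circ> g = id" "g \<circ> ?h = id"
    using g(2,3) by (auto simp: g(1) signed_perm_def fun_eq_iff)
  ultimately show ?thesis using that by blast
qed

lemma finite_dihedral: "finite dihedral"
proof -
  have "dihedral = (\<lambda>(t, a, b). signed_perm t a b) ` (UNIV \<times> {1, -1} \<times> {1, -1})"
    by (auto simp: dihedral_def image_def)
  then show ?thesis by (metis finite.intros finite_SigmaI finite_UNIV finite_imageI)
qed

lemma inj_dihedral: "g \<in> dihedral \<Longrightarrow> inj g"
  by (metis dihedral_inverse inj_on_id inj_on_imageI2)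

section \<open>The canonical form and its invariance\<close>

text \<open>Sets are ordered only by inclusion; sorted lists encode finite sets faithfully and carry
  the linear order that the minimum in \<open>canonical_form\<close> needs.\<close>

definition sorted_form :: "cell set \<Rightarrow> cell list" where
  "sorted_form S = sorted_list_of_set (normal_form S)"

definition canonical_form :: "cell set \<Rightarrow> cell list" where
  "canonical_form S = Min ((\<lambda>g. sorted_form (g ` S)) ` dihedral)"

text \<open>Since \<open>h (v + g c) = h v + h (g c)\<close>, the normal form absorbs the
  translation, and right multiplication by \<open>g\<close> merely permutes the group over which the
  minimum is taken.\<close>

lemma canonical_form_affine:
  assumes "finite S" "S \<noteq> {}" "g \<in> dihedral"
  shows "canonical_form ((\<lambda>c. v + g c) ` S) = canonical_form S"
proof -
  have eq: "sorted_form (h ` (\<lambda>c. v + g c) ` S) = sorted_form ((h \<circ> g) ` S)" if "h \<in> dihedral" for h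
  proof -
    have "h ` (\<lambda>c. v + g c) ` S = (+) (h v) ` (h \<circ> g) ` S"
      using that by (simp add: image_image dihedral_add)
    then show ?thesis using assms
      by (simp add: sorted_form_def normal_form_translate)
  qed
  obtain g' where g': "g' \<in> dihedral" "g' \<circ> g = id" using dihedral_inverse[OF assms(3)] by metis
  have "(\<lambda>h. h \<circ> g) ` dihedral = dihedral"
  proof
    show "(\<lambda>h. h \<circ> g) ` dihedral \<subseteq> dihedral" using assms dihedral_comp by auto
    show "dihedral \<subseteq> (\<lambda>h. h \<circ> g) ` dihedral"
    proof
      fix k assume "k \<in> dihedral"
      then have "k \<circ> g' \<in> dihedral" "k = (k \<circ> g') \<circ> g"
        using g' dihedral_comp by (auto simp: comp_assoc)
      then show "k \<in> (\<lambda>h. h \<circ> g) ` dihedral" by blast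
    qed
  qed
  then have "(\<lambda>h. sorted_form (h ` S)) ` dihedral = (\<lambda>h. sorted_form (h ` S)) ` (\<lambda>h. h \<circ> g) ` dihedral"
    by simp
  also have "\<dots> = (\<lambda>h. sorted_form (h ` (\<lambda>c. v + g c) ` S)) ` dihedral"
    unfolding image_image[of _ "\<lambda>h. h \<circ> g"] by (intro image_cong refl) (simp only: eq)
  finally show ?thesis
    by (simp add: canonical_form_def)
qed

lemma canonical_form_attained:
  obtains g where "g \<in> dihedral" "canonical_form S = sorted_form (g ` S)"
proof -
  have "canonical_form S \<in> (\<lambda>g. sorted_form (g ` S)) ` dihedral"
    unfolding canonical_form_def using finite_dihedral id_in_dihedral by (intro Min_in) auto
  then show ?thesis using that by blast
qed

section \<open>Elementary steps and affine maps of the lattice\<close>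

lemma elementary_step_affine:
  assumes "(S, T) \<in> elementary_step m"
  obtains v g where "g \<in> dihedral" "T = (\<lambda>c. v + g c) ` S"
proof -
  from assms obtain f where T: "T = f ` S"
    and f: "f \<in> unit_shifts \<union> board_rotations m \<union> board_reflections m"
    by (auto simp: elementary_step_def)
  \<comment> \<open>Coordinates run from 1 to \<open>m\<close>, so a reflected coordinate needs the
    offset \<open>m + 1\<close>.\<close>
  have eqs:
    "(\<lambda>(i, j). (i + 1, j)) = (\<lambda>c. (1, 0) + signed_perm False 1 1 c)"
    "(\<lambda>(i, j). (i - 1, j)) = (\<lambda>c. (-1, 0) + signed_perm False 1 1 c)"
    "(\<lambda>(i, j). (i, j + 1)) = (\<lambda>c. (0, 1) + signed_perm False 1 1 c)"
    "(\<lambda>(i, j). (i, j - 1)) = (\<lambda>c. (0, -1) + signed_perm False 1 1 c)"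
    "(\<lambda>(i, j). (j, int m + 1 - i)) = (\<lambda>c. (0, int m + 1) + signed_perm True 1 (-1) c)"
    "(\<lambda>(i, j). (int m + 1 - j, i)) = (\<lambda>c. (int m + 1, 0) + signed_perm True (-1) 1 c)"
    "(\<lambda>(i, j). (int m + 1 - i, j)) = (\<lambda>c. (int m + 1, 0) + signed_perm False (-1) 1 c)"
    "(\<lambda>(i, j). (i, int m + 1 - j)) = (\<lambda>c. (0, int m + 1) + signed_perm False 1 (-1) c)"
    "(\<lambda>(i, j). (j, i)) = (\<lambda>c. (0, 0) + signed_perm True 1 1 c)"
    "(\<lambda>(i, j). (int m + 1 - j, int m + 1 - i)) = (\<lambda>c. (int m + 1, int m + 1) + signed_perm True (-1) (-1) c)"
    by (auto simp: signed_perm_def fun_eq_iff zero_prod_def)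
  have "\<exists>v t a b. a \<in> {1, -1} \<and> b \<in> {1, -1} \<and> f = (\<lambda>c. v + signed_perm t a b c)"
    using f unfolding unit_shifts_def board_rotations_def board_reflections_def eqs
    by (elim UnE insertE emptyE) blast+
  then obtain v t a b where "a \<in> {1, -1}" "b \<in> {1, -1}" "f = (\<lambda>c. v + signed_perm t a b c)"
    by blast
  then show ?thesis using that[of "signed_perm t a b" v] T unfolding dihedral_def by blast
qed

lemma canonical_form_elementary_steps:
  assumes "(S, T) \<in> (elementary_step m)\<^sup>*" "finite S" "S \<noteq> {}"
  shows "finite T \<and> T \<noteq> {} \<and> canonical_form T = canonical_form S"
  using assms(1)
proof (induction rule: rtrancl_induct)
  case base
  then show ?case using assms by simp
next
  case (step T U)
  obtain v g where "g \<in> dihedral" "U = (\<lambda>c. v + g c) ` T"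
    using elementary_step_affine[OF step.hyps(2)] by blast
  then show ?case using step.IH canonical_form_affine[of T g v] by simp
qed

lemma elementary_steps_shift:
  assumes "d \<in> {(1, 0), (-1, 0), (0, 1), (0, -1)}"
    and "S \<subseteq> board m" "(\<lambda>(i, j). (i + int n * fst d, j + int n * snd d)) ` S \<subseteq> board m"
  shows "(S, (\<lambda>(i, j). (i + int n * fst d, j + int n * snd d)) ` S) \<in> (elementary_step m)\<^sup>*"
  using assms(3)
proof (induction n)
  case 0
  then show ?case by simp
next
  case (Suc n)
  let ?shift = "\<lambda>k (i, j). (i + int k * fst d, j + int k * snd d)"
  \<comment> \<open>Each cell lies on the segment between its initial and its final position, both
    on the board.\<close>
  have sub: "?shift n ` S \<subseteq> board m"
  proof
    fix c assume "c \<in> ?shift n ` S"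
    then obtain i j where c: "(i, j) \<in> S" "c = (i + int n * fst d, j + int n * snd d)"
      by auto
    then have "(i, j) \<in> board m" "(i + int (Suc n) * fst d, j + int (Suc n) * snd d) \<in> board m"
      using assms(2) Suc.prems by auto
    then show "c \<in> board m"
      using assms(1) c(2) by (auto simp: board_def algebra_simps)
  qed
  have "\<exists>f\<in>unit_shifts. ?shift (Suc n) ` S = f ` ?shift n ` S"
  proof (rule bexI)
    show "(\<lambda>(i, j). (i + fst d, j + snd d)) \<in> unit_shifts"
      using assms(1) by (auto simp: unit_shifts_def)
    show "?shift (Suc n) ` S = (\<lambda>(i, j). (i + fst d, j + snd d)) ` ?shift n ` S"
      by (auto simp: image_image split_beta algebra_simps)
  qed
  then have "(?shift n ` S, ?shift (Suc n) ` S) \<in> elementary_step m"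
    unfolding elementary_step_def using sub Suc.prems by blast
  then show ?case using Suc.IH[OF sub] by (rule rtrancl_into_rtrancl[rotated])
qed

lemma elementary_steps_translate:
  assumes "S \<subseteq> board m" "(+) v ` S \<subseteq> board m"
  shows "(S, (+) v ` S) \<in> (elementary_step m)\<^sup>*"
proof -
  obtain a b where v: "v = (a, b)" by fastforce
  \<comment> \<open>The translation is done one axis at a time. Halfway, the first coordinates are
    those of the target and the second those of the source, and the board is a product.\<close>
  have mid: "(+) (a, 0) ` S \<subseteq> board m"
    using assms v by (auto simp: board_def)
  have axis: "(T, (+) (int n * fst d, int n * snd d) ` T) \<in> (elementary_step m)\<^sup>*"
    if "d \<in> {(1, 0), (-1, 0), (0, 1), (0, -1)}" "T \<subseteq> board m"
      "(+) (int n * fst d, int n * snd d) ` T \<subseteq> board m" for T n d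
  proof -
    have "(\<lambda>(i, j). (i + int n * fst d, j + int n * snd d)) = (+) (int n * fst d, int n * snd d)"
      by auto
    then show ?thesis using elementary_steps_shift[of d T m n] that by simp
  qed
  have "(S, (+) (a, 0) ` S) \<in> (elementary_step m)\<^sup>*"
    using axis[of "(1, 0)" S "nat a"] axis[of "(-1, 0)" S "nat (- a)"] assms(1) mid
    by (cases "a \<ge> 0") auto
  moreover have "(+) (0, b) ` (+) (a, 0) ` S = (+) v ` S"
    using v by (simp add: image_image add.assoc[symmetric])
  then have "((+) (a, 0) ` S, (+) v ` S) \<in> (elementary_step m)\<^sup>*"
    using axis[of "(0, 1)" "(+) (a, 0) ` S" "nat b"] axis[of "(0, -1)" "(+) (a, 0) ` S" "nat (- b)"]
      assms(2) mid
    by (cases "b \<ge> 0") auto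
  ultimately show ?thesis by (rule rtrancl_trans)
qed

text \<open>Each linear symmetry becomes a symmetry of the board after translating every negated
  coordinate by \<open>m + 1\<close>.\<close>

lemma elementary_steps_board_symmetry:
  assumes "S \<subseteq> board m" "g \<in> dihedral"
  obtains v where "(+) v ` g ` S \<subseteq> board m" "(S, (+) v ` g ` S) \<in> (elementary_step m)\<^sup>*"
proof -
  from assms(2) obtain t a b where g: "g = signed_perm t a b" "a \<in> {1, -1}" "b \<in> {1, -1}"
    by (auto simp: dihedral_def)
  define f where "f t a b = (\<lambda>c. (if a = 1 then 0 else int m + 1, if b = 1 then 0 else int m + 1)
    + signed_perm t a b c)" for t and a b :: int
  have board: "f t a b ` T \<subseteq> board m" if "T \<subseteq> board m" "a \<in> {1, -1}" "b \<in> {1, -1}" for T t a b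
    using that by (fastforce simp: f_def signed_perm_def board_def)
  have single: "(T, f t a b ` T) \<in> elementary_step m"
    if "T \<subseteq> board m" "(t, a, b) \<in> {(False, -1, 1), (False, 1, -1), (True, 1, 1), (True, -1, -1),
      (True, 1, -1), (True, -1, 1)}" for T t a b
  proof -
    have "f t a b \<in> board_rotations m \<union> board_reflections m"
      using that(2) unfolding board_rotations_def board_reflections_def
      by (auto simp: f_def signed_perm_def fun_eq_iff)
    moreover have "f t a b ` T \<subseteq> board m" by (rule board) (use that in auto)
    ultimately show ?thesis using that(1) unfolding elementary_step_def by blast
  qed
  have "(S, f t a b ` S) \<in> (elementary_step m)\<^sup>*"
  \<comment> \<open>Only the identity and the half turn are not generators; the half turn is a
    product of two reflections.\<close>
  proof (cases "(t, a, b) \<in> {(False, 1, 1), (False, -1, -1)}")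
    case False
    then show ?thesis using single[OF assms(1), of t a b] g by auto
  next
    case True
    then consider "f t a b = id" | "f t a b = f False (-1) 1 \<circ> f False 1 (-1)"
      by (auto simp: f_def signed_perm_def fun_eq_iff)
    then show ?thesis
    proof cases
      case 1
      then show ?thesis by simp
    next
      case 2
      have "(S, f False 1 (-1) ` S) \<in> elementary_step m"
        using single assms(1) by simp
      moreover have "(f False 1 (-1) ` S, f False (-1) 1 ` f False 1 (-1) ` S) \<in> elementary_step m"
        by (intro single board) (use assms(1) in auto)
      ultimately show ?thesis using 2 by (simp add: image_comp)
    qed
  qed
  moreover have "f t a b ` S = (+) (if a = 1 then 0 else int m + 1, if b = 1 then 0 else int m + 1) ` g ` S"
    by (simp add: f_def g image_image)
  ultimately show ?thesis using that board[OF assms(1), of a b t] g by metis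
qed

text \<open>For the converse, equal invariants make \<open>T\<close> a translate of a dihedral image
  of \<open>S\<close>. A board symmetry realises the linear part by steps on the board, and a
  translation on the board does the rest.\<close>

lemma elementary_steps_iff_canonical_form:
  assumes "S \<subseteq> board m" "T \<subseteq> board m" "S \<noteq> {}" "T \<noteq> {}"
  shows "(S, T) \<in> (elementary_step m)\<^sup>* \<longleftrightarrow> canonical_form S = canonical_form T"
proof
  have fin: "finite S" "finite T"
    using assms finite_subset[of _ "board m"] by (auto simp: board_def)
  show "canonical_form S = canonical_form T" if "(S, T) \<in> (elementary_step m)\<^sup>*"
    using canonical_form_elementary_steps[OF that] fin assms by simp
  assume eq: "canonical_form S = canonical_form T"
  obtain g where g: "g \<in> dihedral" "canonical_form S = sorted_form (g ` S)"
    using canonical_form_attained by blast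
  obtain h where h: "h \<in> dihedral" "canonical_form T = sorted_form (h ` T)"
    using canonical_form_attained by blast
  obtain h' where h': "h' \<in> dihedral" "h' \<circ> h = id" using dihedral_inverse[OF h(1)] by metis
  have "normal_form (g ` S) = normal_form (h ` T)"
    using eq g(2) h(2) fin unfolding sorted_form_def
    by (metis finite_imageI normal_form_def sorted_list_of_set.set_sorted_key_list_of_set)
  then have "(+) (Min (h ` T)) ` normal_form (g ` S) = h ` T"
    by (simp add: normal_form_def image_image)
  then have "h ` T = (+) (Min (h ` T) - Min (g ` S)) ` g ` S"
    by (simp add: normal_form_def image_image algebra_simps)
  then obtain w where "h ` T = (+) w ` g ` S" ..
  then have "h' ` h ` T = h' ` (+) w ` g ` S" by simp
  then have T: "T = (+) (h' w) ` (h' \<circ> g) ` S"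
    using h' by (simp add: image_comp) (simp add: comp_def dihedral_add)
  have "h' \<circ> g \<in> dihedral" using g h' dihedral_comp by blast
  then obtain v where v: "(+) v ` (h' \<circ> g) ` S \<subseteq> board m"
    "(S, (+) v ` (h' \<circ> g) ` S) \<in> (elementary_step m)\<^sup>*"
    using elementary_steps_board_symmetry assms(1) by metis
  have "T = (+) (h' w - v) ` (+) v ` (h' \<circ> g) ` S"
    unfolding T by (simp add: image_image add.assoc[symmetric])
  then show "(S, T) \<in> (elementary_step m)\<^sup>*"
    using elementary_steps_translate[OF v(1), of "h' w - v"] assms(2) v(2)
    by (metis rtrancl_trans)
qed

section \<open>Knight cycles in the plane\<close>

definition knight_cycle :: "cell list \<Rightarrow> bool" where
  "knight_cycle cs \<longleftrightarrow> cs \<noteq> [] \<and> distinct cs \<and> successively knight_move cs \<and>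
     knight_move (last cs) (hd cs)"

lemma closed_knight_paths_iff_knight_cycle:
  assumes "n > 0"
  shows "S \<in> closed_knight_paths m n \<longleftrightarrow>
    S \<subseteq> board m \<and> (\<exists>cs. length cs = n \<and> knight_cycle cs \<and> set cs = S)"
proof safe
  assume "S \<in> closed_knight_paths m n"
  then obtain c where c: "S = c ` {1..n}" "inj_on c {1..n}"
    "\<forall>k\<in>{1..<n}. knight_move (c k) (c (k + 1))" "knight_move (c n) (c 1)"
    by (auto simp: closed_knight_paths_def)
  let ?cs = "map c [1..<Suc n]"
  have eq: "{1..<Suc n} = {1..n}" by auto
  have "knight_cycle ?cs"
    unfolding knight_cycle_def
  proof (intro conjI)
    show "?cs \<noteq> []" using assms by simp
    show "distinct ?cs" using c(2) by (simp only: distinct_map set_upt eq distinct_upt)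
    show "successively knight_move ?cs"
      using c(3) by (auto simp: successively_conv_nth simp del: upt_Suc)
    show "knight_move (last ?cs) (hd ?cs)"
      using c(4) assms by (simp add: last_map hd_map del: upt_Suc)
  qed
  moreover have "length ?cs = n" "set ?cs = S"
    by (simp del: upt_Suc) (simp only: set_map set_upt eq c(1))
  ultimately show "\<exists>cs. length cs = n \<and> knight_cycle cs \<and> set cs = S" by blast
next
  fix cs assume cs: "knight_cycle cs" "n = length cs" "set cs \<subseteq> board m"
  let ?c = "\<lambda>k. cs ! (k - 1)"
  have inj: "inj_on ?c {1..length cs}"
    using cs(1) by (auto simp: inj_on_def knight_cycle_def nth_eq_iff_index_eq)
  have "?c ` {1..length cs} = (!) cs ` ((\<lambda>k. k - 1) ` {1..length cs})"
    by (simp add: image_image)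
  also have "(\<lambda>k. k - 1) ` {1..length cs} = {..<length cs}"
    by (auto simp: image_iff intro!: bexI[of _ "Suc _"])
  finally have img: "?c ` {1..length cs} = set cs"
    by (auto simp: set_conv_nth)
  have "\<forall>k\<in>{1..<length cs}. knight_move (?c k) (?c (k + 1))"
  proof
    fix k assume "k \<in> {1..<length cs}"
    then obtain l where "k = Suc l" "Suc l < length cs" by (cases k) auto
    then show "knight_move (?c k) (?c (k + 1))"
      using cs(1) by (simp add: knight_cycle_def successively_conv_nth)
  qed
  moreover have "knight_move (?c (length cs)) (?c 1)"
    using cs(1) by (auto simp: knight_cycle_def last_conv_nth hd_conv_nth)
  ultimately show "set cs \<in> closed_knight_paths m (length cs)"
    using cs(3) inj img unfolding closed_knight_paths_def mem_Collect_eq by metis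
qed (auto simp: closed_knight_paths_def)

lemma knight_move_iff:
  "knight_move c d \<longleftrightarrow> \<bar>fst c - fst d\<bar> = 1 \<and> \<bar>snd c - snd d\<bar> = 2 \<or> \<bar>fst c - fst d\<bar> = 2 \<and> \<bar>snd c - snd d\<bar> = 1"
  by (auto simp: knight_move_def doubleton_eq_iff)

text \<open>The linear part keeps or swaps the two absolute differences, and the unordered set
  \<open>{1, 2}\<close> does not see the swap.\<close>

lemma knight_move_affine:
  assumes "g \<in> dihedral"
  shows "knight_move (v + g c) (v + g d) \<longleftrightarrow> knight_move c d"
proof -
  obtain t a b where g: "g = signed_perm t a b" "a \<in> {1, -1}" "b \<in> {1, -1}"
    using assms by (auto simp: dihedral_def)
  have "\<bar>a * x - a * y\<bar> = \<bar>x - y\<bar>" "\<bar>b * x - b * y\<bar> = \<bar>x - y\<bar>" for x y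
    using g(2,3) by auto
  then show ?thesis
    by (cases c; cases d; cases v; cases t)
      (simp_all add: g(1) knight_move_def signed_perm_def insert_commute)
qed

lemma knight_cycle_affine:
  assumes "g \<in> dihedral" "knight_cycle cs"
  shows "knight_cycle (map (\<lambda>c. v + g c) cs)"
  using assms inj_dihedral[OF assms(1)]
  by (auto simp: knight_cycle_def distinct_map successively_map last_map hd_map knight_move_affine
      inj_on_def)

text \<open>Sending the head to the end turns the closing move into an inner move and the first move
  into the closing one.\<close>

lemma knight_cycle_rotate: "knight_cycle cs \<Longrightarrow> knight_cycle (rotate k cs)"
proof (induction k)
  case (Suc k)
  obtain x xs where xs: "rotate k cs = x # xs"
    using Suc by (cases "rotate k cs") (auto simp: knight_cycle_def)
  then have "knight_cycle (x # xs)" using Suc by simp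
  then have "knight_cycle (xs @ [x])"
    using successively_append_iff[of knight_move xs "[x]"]
    by (auto simp: knight_cycle_def successively_Cons hd_append split: if_splits)
  then show ?case using xs by simp
qed simp

lemma knight_cycle_start:
  assumes "knight_cycle cs" "c \<in> set cs"
  obtains ds where "knight_cycle ds" "set ds = set cs" "length ds = length cs" "hd ds = c"
proof -
  obtain k where "k < length cs" "c = cs ! k" using assms(2) by (auto simp: in_set_conv_nth)
  then have "hd (rotate k cs) = c" using hd_rotate_conv_nth[of cs k] assms(2) by force
  then show ?thesis using that[of "rotate k cs"] knight_cycle_rotate[OF assms(1)] by simp
qed

section \<open>The extent of a knight cycle\<close>

text \<open>From \<open>q\<close> to \<open>z\<close> there are \<open>length qs + 1\<close> moves,
  each changing a coordinate by at most 2.\<close>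

lemma knight_walk_bound:
  assumes "successively knight_move (q # qs)" "knight_move (last (q # qs)) z"
  shows "\<bar>fst q - fst z\<bar> \<le> 2 * int (length qs) + 2 \<and> \<bar>snd q - snd z\<bar> \<le> 2 * int (length qs) + 2"
  using assms
proof (induction qs arbitrary: q)
  case Nil
  then show ?case by (auto simp: knight_move_iff)
next
  case (Cons p qs)
  then have "\<bar>fst p - fst z\<bar> \<le> 2 * int (length qs) + 2 \<and> \<bar>snd p - snd z\<bar> \<le> 2 * int (length qs) + 2"
    by simp
  moreover have "knight_move q p" using Cons.prems by simp
  ultimately show ?case by (auto simp: knight_move_iff)
qed

text \<open>Of the two arcs of the cycle joining two cells, one has at most half of the moves.\<close>

lemma knight_cycle_diameter:
  assumes "knight_cycle cs" "p \<in> set cs" "q \<in> set cs"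
  shows "\<bar>fst p - fst q\<bar> \<le> int (length cs) \<and> \<bar>snd p - snd q\<bar> \<le> int (length cs)"
proof (cases "p = q")
  case False
  obtain ds where ds: "knight_cycle ds" "set ds = set cs" "length ds = length cs" "hd ds = q"
    using knight_cycle_start assms(1,3) by blast
  then obtain zs where zs: "ds = q # zs" by (cases ds) (auto simp: knight_cycle_def)
  then have "p \<in> set zs" using ds(2) False assms(2) by auto
  then obtain xs ys where split: "ds = q # xs @ p # ys"
    using zs by (auto dest: split_list)
  have "successively knight_move (p # ys)" "knight_move (last (p # ys)) q"
    using ds(1) unfolding split by (auto simp: knight_cycle_def successively_append_iff successively_Cons)
  from knight_walk_bound[OF this]
  have 1: "\<bar>fst p - fst q\<bar> \<le> 2 * int (length ys) + 2 \<and> \<bar>snd p - snd q\<bar> \<le> 2 * int (length ys) + 2" .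
  have "successively knight_move (q # xs)" "knight_move (last (q # xs)) p"
    using ds(1) unfolding split by (auto simp: knight_cycle_def successively_append_iff successively_Cons)
  from knight_walk_bound[OF this]
  have 2: "\<bar>fst q - fst p\<bar> \<le> 2 * int (length xs) + 2 \<and> \<bar>snd q - snd p\<bar> \<le> 2 * int (length xs) + 2" .
  \<comment> \<open>The bounds of the two arcs add up to twice the length of the cycle, so the
    smaller is at most that length.\<close>
  have "int (length cs) = int (length xs) + int (length ys) + 2" using ds(3) split by simp
  then show ?thesis using 1 2 by linarith
qed simp

lemma knight_cycle_fits_on_board:
  assumes "knight_cycle cs"
  obtains v where "(+) v ` set cs \<subseteq> board (length cs + 1)"
proof -
  have ne: "set cs \<noteq> {}" using assms by (simp add: knight_cycle_def)
  \<comment> \<open>The least row and the least column move to 1; by the diameter bound the largest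
    are then at most \<open>length cs + 1\<close>.\<close>
  let ?v = "(1 - Min (fst ` set cs), 1 - Min (snd ` set cs))"
  have "?v + c \<in> board (length cs + 1)" if c: "c \<in> set cs" for c
  proof -
    have "Min (fst ` set cs) \<in> fst ` set cs" "Min (snd ` set cs) \<in> snd ` set cs"
      using ne by (auto intro!: Min_in)
    then obtain p q where "p \<in> set cs" "fst p = Min (fst ` set cs)" "q \<in> set cs" "snd q = Min (snd ` set cs)"
      by force
    moreover have "Min (fst ` set cs) \<le> fst c" "Min (snd ` set cs) \<le> snd c" using c by auto
    ultimately show ?thesis
      using knight_cycle_diameter[OF assms c, of p] knight_cycle_diameter[OF assms c, of q]
      by (cases c) (auto simp: board_def)
  qed
  then show ?thesis using that[of ?v] by blast
qed

section \<open>Enumeration of the canonical forms\<close>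

text \<open>These functions are evaluated by rewriting, which computes both arguments of a conjunction or
  disjunction but only the selected branch of a conditional; hence the nested conditionals.\<close>

fun insert_cell :: "cell \<Rightarrow> cell list \<Rightarrow> cell list" where
  "insert_cell (i, j) [] = [(i, j)]"
| "insert_cell (i, j) ((a, b) # cs) =
     (if (if i = a then j \<le> b else i < a) then (i, j) # (a, b) # cs
      else (a, b) # insert_cell (i, j) cs)"

lemma insert_cell_eq_insort: "insert_cell = insort"
proof (intro ext)
  show "insert_cell c cs = insort c cs" for c cs
    by (induction c cs rule: insert_cell.induct) auto
qed

fun cell_member :: "int \<Rightarrow> int \<Rightarrow> cell list \<Rightarrow> bool" where
  "cell_member i j [] = False"
| "cell_member i j ((a, b) # cs) =
     (if (if i = a then j = b else False) then True else cell_member i j cs)"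

lemma cell_member_iff: "cell_member i j cs \<longleftrightarrow> (i, j) \<in> set cs"
  by (induction i j cs rule: cell_member.induct) auto

fun lex_le :: "cell list \<Rightarrow> cell list \<Rightarrow> bool" where
  "lex_le ((i, j) # xs) ((a, b) # ys) =
     (if i = a then if j = b then lex_le xs ys else j < b else i < a)"
| "lex_le [] ys = True"
| "lex_le (x # xs) [] = False"

lemma lex_le_iff: "lex_le xs ys \<longleftrightarrow> xs \<le> ys"
  by (induction xs ys rule: lex_le.induct) auto

text \<open>The branch selected by a conditional is traversed again, which is too slow for long lists.
  So the comparison is passed as a pair of Boolean arguments.\<close>

function (sequential) merge :: "cell list list \<Rightarrow> cell list list \<Rightarrow> cell list list"
  and merge_step ::
    "bool \<Rightarrow> bool \<Rightarrow> cell list \<Rightarrow> cell list list \<Rightarrow> cell list \<Rightarrow> cell list list \<Rightarrow> cell list list"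
where
  "merge [] ys = ys"
| "merge (x # xs) [] = x # xs"
| "merge (x # xs) (y # ys) = merge_step (lex_le x y) (lex_le y x) x xs y ys"
| "merge_step False q x xs y ys = y # merge (x # xs) ys"
| "merge_step True False x xs y ys = x # merge xs (y # ys)"
| "merge_step True True x xs y ys = x # merge xs ys"
  by pat_completeness auto
termination
  \<comment> \<open>In terms of the tails, \<open>merge\<close> on two nonempty lists has weight
    \<open>2 * (length xs + length ys) + 4\<close> and its recursive calls at most
    \<open>+ 2\<close>; the 3 puts \<open>merge_step\<close> between.\<close>
  by (relation "measure (case_sum (\<lambda>(xs, ys). 2 * (length xs + length ys))
    (\<lambda>(p, q, x, xs, y, ys). 2 * (length xs + length ys) + 3))") auto

lemma set_merge: "set (merge xs ys) = set xs \<union> set ys"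
  and set_merge_step: "p = lex_le x y \<Longrightarrow> q = lex_le y x \<Longrightarrow>
    set (merge_step p q x xs y ys) = set (x # xs) \<union> set (y # ys)"
  by (induction xs ys and p q x xs y ys rule: merge_merge_step.induct) (auto simp: lex_le_iff)

text \<open>Equal heads are kept only once, so strictness survives. Several walks have the same cell
  set, and the final count relies on this removal of duplicates.\<close>

lemma sorted_merge:
    "sorted_wrt (<) xs \<Longrightarrow> sorted_wrt (<) ys \<Longrightarrow> sorted_wrt (<) (merge xs ys)"
  and sorted_merge_step: "p = lex_le x y \<Longrightarrow> q = lex_le y x \<Longrightarrow>
    sorted_wrt (<) (x # xs) \<Longrightarrow> sorted_wrt (<) (y # ys) \<Longrightarrow>
    sorted_wrt (<) (merge_step p q x xs y ys)"
proof (induction xs ys and p q x xs y ys rule: merge_merge_step.induct)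
  case (4 q x xs y ys)
  then show ?case by (fastforce simp: set_merge lex_le_iff)
next
  case (5 x xs y ys)
  then show ?case by (fastforce simp: set_merge lex_le_iff)
next
  case (6 x xs y ys)
  then show ?case by (auto simp: set_merge lex_le_iff)
qed auto

section \<open>The executable test for canonical forms\<close>

fun subtract_head :: "cell list \<Rightarrow> cell list" where
  "subtract_head [] = []"
| "subtract_head ((i, j) # cs) = map (\<lambda>(a, b). (a - i, b - j)) ((i, j) # cs)"

lemma subtract_head_eq: "cs \<noteq> [] \<Longrightarrow> subtract_head cs = map ((+) (- hd cs)) cs"
  by (cases cs rule: subtract_head.cases) auto

text \<open>Sorting puts the least cell at the head, so subtracting the head normalises. Translation
  keeps the list strictly sorted, and such a list is determined by its set.\<close>

lemma sorted_form_set: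
  assumes "distinct cs" "cs \<noteq> []"
  shows "subtract_head (foldr insert_cell cs []) = sorted_form (set cs)"
proof -
  have sort: "foldr insert_cell cs [] = sort cs"
    by (simp add: insert_cell_eq_insort sort_key_def)
  have ne: "sort cs \<noteq> []" using assms(2) by (metis set_empty set_sort)
  have "hd (sort cs) = Min (set (sort cs))"
    using ne sorted_sort[of cs]
    by (cases "sort cs") (auto intro!: Min_eqI[symmetric])
  then have hd: "hd (sort cs) = Min (set cs)" by simp
  have "sorted_wrt (<) (sort cs)" using assms(1) by (simp add: strict_sorted_iff)
  then have "sorted_wrt (<) (map ((+) (- Min (set cs))) (sort cs))"
    unfolding sorted_wrt_map by (rule sorted_wrt_mono_rel[rotated]) (rule strict_monoD[OF strict_mono_add_cell])
  then have "map ((+) (- Min (set cs))) (sort cs) = sorted_form (set cs)"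
    unfolding sorted_form_def normal_form_def
    by (intro sorted_distinct_set_unique) (auto simp: strict_sorted_iff)
  then show ?thesis by (simp only: sort subtract_head_eq[OF ne] hd)
qed

fun least_image :: "cell list \<Rightarrow> (cell \<Rightarrow> cell) list \<Rightarrow> bool" where
  "least_image cs [] = True"
| "least_image cs (g # gs) =
     (if lex_le cs (subtract_head (foldr insert_cell (map g cs) [])) then least_image cs gs else False)"

lemma least_image_iff:
  assumes "distinct cs" "cs \<noteq> []" "set gs \<subseteq> dihedral"
  shows "least_image cs gs \<longleftrightarrow> (\<forall>g\<in>set gs. cs \<le> sorted_form (g ` set cs))"
  using assms(3)
proof (induction gs)
  case (Cons g gs)
  have "distinct (map g cs)"
    using Cons.prems assms(1) inj_dihedral by (auto simp: distinct_map intro: inj_on_subset)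
  then have "subtract_head (foldr insert_cell (map g cs) []) = sorted_form (g ` set cs)"
    using sorted_form_set[of "map g cs"] assms(2) by simp
  then show ?case using Cons by (simp add: lex_le_iff)
qed simp

text \<open>The identity is left out: the test is applied to lists that are already normalised,
  which it fixes.\<close>

definition nontrivial_symmetries :: "(cell \<Rightarrow> cell) list" where
  "nontrivial_symmetries =
     [\<lambda>(i, j). (i, -j), \<lambda>(i, j). (-i, j), \<lambda>(i, j). (-i, -j),
      \<lambda>(i, j). (j, i), \<lambda>(i, j). (-j, i), \<lambda>(i, j). (j, -i), \<lambda>(i, j). (-j, -i)]"

lemma dihedral_eq: "dihedral = insert id (set nontrivial_symmetries)"
proof -
  have "dihedral = {signed_perm False 1 1, signed_perm False 1 (-1), signed_perm False (-1) 1,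
      signed_perm False (-1) (-1), signed_perm True 1 1, signed_perm True (-1) 1,
      signed_perm True 1 (-1), signed_perm True (-1) (-1)}"
    unfolding dihedral_def by auto (metis (full_types))+
  moreover have "signed_perm False 1 1 = id" by (auto simp: signed_perm_def)
  ultimately show ?thesis
    by (simp add: nontrivial_symmetries_def signed_perm_def)
qed

text \<open>With \<open>Min S = 0\<close> the identity contributes the list of \<open>S\<close>
  itself to the minimum, so it suffices to compare that list with the other seven images.\<close>

lemma least_image_iff_canonical_form:
  assumes "finite S" "S \<noteq> {}" "Min S = 0"
  shows "least_image (sorted_list_of_set S) nontrivial_symmetries \<longleftrightarrow>
    canonical_form S = sorted_list_of_set S"
proof -
  let ?l = "sorted_list_of_set S"
  have set: "set ?l = S" "distinct ?l" "?l \<noteq> []" using assms by auto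
  have l: "sorted_form (id ` S) = ?l"
    using assms by (simp add: sorted_form_def normal_form_def)
  have "least_image ?l nontrivial_symmetries \<longleftrightarrow> (\<forall>g\<in>dihedral. ?l \<le> sorted_form (g ` S))"
    using least_image_iff[OF set(2,3), of nontrivial_symmetries] l unfolding set dihedral_eq by auto
  also have "\<dots> \<longleftrightarrow> canonical_form S = ?l"
    unfolding canonical_form_def
    using finite_dihedral id_in_dihedral l by (subst Min_eq_iff) (auto intro!: image_eqI[of _ _ id])
  finally show ?thesis .
qed

text \<open>The search runs through the knight walks that start at the origin, their least cell, and have
  \<open>k\<close> further cells. A coordinate changes by at most 2 in each move, so only the cells with
  coordinates bounded by \<open>b = 2 * k\<close> can still be closed up to a cycle.\<close>

definition reachable :: "int \<Rightarrow> int \<Rightarrow> int \<Rightarrow> bool" where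
  "reachable b i j =
     (if i < 0 then False else if b < i then False else if b < j then False
      else if j < - b then False else if i = 0 then 0 < j else True)"

text \<open>The rest of the search is passed as \<open>f\<close>, so that \<open>search\<close> is
  primitive recursive and \<open>f\<close> runs only at admissible cells.\<close>

definition visit :: "(int \<Rightarrow> int \<Rightarrow> cell list \<Rightarrow> cell list list) \<Rightarrow>
    int \<Rightarrow> cell list \<Rightarrow> int \<Rightarrow> int \<Rightarrow> cell list list" where
  "visit f b vis i j =
     (if if reachable b i j then cell_member i j vis else True then []
      else f i j (insert_cell (i, j) vis))"

primrec search :: "nat \<Rightarrow> int \<Rightarrow> int \<Rightarrow> int \<Rightarrow> cell list \<Rightarrow> cell list list" where
  "search 0 b i j vis =
     (if cell_member i j [(1, -2), (1, 2), (2, -1), (2, 1)]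
      then if least_image vis nontrivial_symmetries then [vis] else [] else [])"
| "search (Suc k) b i j vis =
     merge
       (merge
         (merge (visit (search k (b - 2)) b vis (i + 1) (j + 2))
                (visit (search k (b - 2)) b vis (i + 1) (j - 2)))
         (merge (visit (search k (b - 2)) b vis (i - 1) (j + 2))
                (visit (search k (b - 2)) b vis (i - 1) (j - 2))))
       (merge
         (merge (visit (search k (b - 2)) b vis (i + 2) (j + 1))
                (visit (search k (b - 2)) b vis (i + 2) (j - 1)))
         (merge (visit (search k (b - 2)) b vis (i - 2) (j + 1))
                (visit (search k (b - 2)) b vis (i - 2) (j - 1))))"

section \<open>Correctness of the search\<close>

lemma sorted_search: "sorted_wrt (<) (search k b i j vis)"
proof (induction k arbitrary: b i j vis)
  case (Suc k)
  then have "sorted_wrt (<) (visit (search k b') b vis i j)" for b b' i j vis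
    by (simp add: visit_def)
  then show ?case by (simp add: sorted_merge)
qed simp

lemma set_search_Suc:
  "set (search (Suc k) b i j vis) =
     (\<Union>c \<in> {c. knight_move (i, j) c}. set (visit (search k (b - 2)) b vis (fst c) (snd c)))"
proof -
  have abs: "\<bar>x - y\<bar> = 1 \<longleftrightarrow> y = x + 1 \<or> y = x - 1" "\<bar>x - y\<bar> = 2 \<longleftrightarrow> y = x + 2 \<or> y = x - 2"
    for x y :: int by linarith+
  have "{c. knight_move (i, j) c} = {(i + 1, j + 2), (i + 1, j - 2), (i - 1, j + 2), (i - 1, j - 2),
      (i + 2, j + 1), (i + 2, j - 1), (i - 2, j + 1), (i - 2, j - 1)}"
    unfolding set_eq_iff split_paired_All mem_Collect_eq knight_move_iff abs fst_conv snd_conv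
      insert_iff empty_iff prod.inject
    by (intro allI) argo
  then show ?thesis by (simp only: search.simps set_merge UN_insert UN_empty fst_conv snd_conv Un_ac) blast
qed

text \<open>Specifies a search state: \<open>cs\<close> is a way to close up a partial tour that has
  visited \<open>vis\<close> and stands at \<open>c\<close>.\<close>

definition completes :: "cell list \<Rightarrow> cell \<Rightarrow> cell list \<Rightarrow> bool" where
  "completes vis c cs \<longleftrightarrow> distinct cs \<and> set cs \<inter> set vis = {} \<and> (\<forall>d\<in>set cs. 0 < d) \<and>
     successively knight_move (c # cs) \<and> knight_move (last (c # cs)) 0"

lemma completes_Cons:
  "completes vis c (d # cs) \<longleftrightarrow>
     knight_move c d \<and> 0 < d \<and> d \<notin> set vis \<and> completes (insert_cell d vis) d cs"
  by (auto simp: completes_def insert_cell_eq_insort set_insort_key)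

text \<open>Soundness of the pruning: the walk bound with \<open>z = 0\<close> applies, as
  \<open>length cs + 1\<close> moves lead from \<open>c\<close> back to the origin.\<close>

lemma completes_reachable:
  assumes "completes vis c cs" "0 < c"
  shows "reachable (2 * int (Suc (length cs))) (fst c) (snd c)"
  using assms knight_walk_bound[of c cs 0]
  by (cases c) (auto simp: completes_def reachable_def zero_prod_def)

text \<open>Induction on the number of missing cells. A cell refused by \<open>visit\<close> is
  already used or admits no completion, so nothing is lost.\<close>

lemma set_search:
  assumes "sorted_wrt (<) vis" "0 \<le> (i, j)"
  shows "set (search k (2 * int k) i j vis) =
    {sorted_list_of_set (set vis \<union> set cs) | cs. length cs = k \<and> completes vis (i, j) cs \<and>
      least_image (sorted_list_of_set (set vis \<union> set cs)) nontrivial_symmetries}"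
  using assms
proof (induction k arbitrary: i j vis)
  case 0
  \<comment> \<open>These are the four neighbours of the origin above it in the lexicographic order;
    \<open>0 \<le> (i, j)\<close> excludes the other four.\<close>
  have "knight_move (i, j) 0 \<longleftrightarrow> cell_member i j [(1, -2), (1, 2), (2, -1), (2, 1)]"
    using 0(2) by (auto simp: knight_move_iff cell_member_iff zero_prod_def)
  moreover have "sorted_list_of_set (set vis) = vis"
    using 0(1) by (simp add: sorted_list_of_set.idem_if_sorted_distinct strict_sorted_iff)
  ultimately show ?case by (auto simp: completes_def)
next
  case (Suc k)
  have pos: "0 < c" if "reachable b (fst c) (snd c)" for b c
    using that by (cases c) (auto simp: reachable_def zero_prod_def split: if_splits)
  define good where "good vs \<longleftrightarrow> least_image (sorted_list_of_set vs) nontrivial_symmetries" for vs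
  have visit: "set (visit (search k (2 * int (Suc k) - 2)) (2 * int (Suc k)) vis (fst c) (snd c)) =
    {sorted_list_of_set (set vis \<union> set (c # cs)) | cs. length cs = k \<and> 0 < c \<and> c \<notin> set vis \<and>
      completes (insert_cell c vis) c cs \<and> good (set vis \<union> set (c # cs))}" (is "?L = ?R") for c
  proof (cases "reachable (2 * int (Suc k)) (fst c) (snd c) \<and> c \<notin> set vis")
    case False
    then have "?L = {}" by (simp add: visit_def cell_member_iff)
    moreover have "?R = {}"
      using False completes_reachable[of "insert_cell c vis" c] by fastforce
    ultimately show ?thesis by simp
  next
    case True
    then have c: "0 < c" using pos by blast
    have sorted: "sorted_wrt (<) (insert_cell c vis)"
      using Suc.prems(1) True by (auto simp: insert_cell_eq_insort strict_sorted_iff sorted_insort distinct_insort)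
    have "?L = set (search k (2 * int k) (fst c) (snd c) (insert_cell c vis))"
      using True by (simp add: visit_def cell_member_iff)
    also have "\<dots> = ?R"
      using Suc.IH[OF sorted, of "fst c" "snd c"] c True
      by (simp add: insert_cell_eq_insort set_insort_key good_def order_less_imp_le)
    finally show ?thesis .
  qed
  have "set (search (Suc k) (2 * int (Suc k)) i j vis) =
    {sorted_list_of_set (set vis \<union> set (c # cs)) | c cs. length cs = k \<and> completes vis (i, j) (c # cs) \<and>
      good (set vis \<union> set (c # cs))}"
    unfolding set_search_Suc visit completes_Cons by blast
  also have "\<dots> = {sorted_list_of_set (set vis \<union> set cs) | cs. length cs = Suc k \<and> completes vis (i, j) cs \<and>
      good (set vis \<union> set cs)}"
    unfolding length_Suc_conv by blast
  finally show ?case unfolding good_def .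
qed

section \<open>Counting the equivalence classes\<close>

lemma knight_cycle_Cons_completes:
  "knight_cycle (0 # cs) \<and> Min (set (0 # cs)) = 0 \<longleftrightarrow> completes [0] 0 cs"
proof -
  have "Min (set (0 # cs)) = 0 \<longleftrightarrow> (\<forall>d\<in>set cs. 0 \<le> d)"
    by (subst Min_eq_iff) auto
  then show ?thesis
    by (auto simp: knight_cycle_def completes_def order.strict_iff_order)
qed

text \<open>The search ignores the board: normalising leads from the board to the plane, and the
  diameter bound leads back. With the origin fixed, \<open>n - 1 = Suc k\<close> cells remain to be
  found.\<close>

lemma canonical_forms_eq_search:
  "canonical_form ` closed_knight_paths (Suc (Suc k) + 1) (Suc (Suc k)) =
     set (search (Suc k) (2 * int (Suc k)) 0 0 [0])"
  (is "canonical_form ` ?X = ?R")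
proof -
  let ?n = "Suc (Suc k)"
  have search: "l \<in> ?R \<longleftrightarrow> (\<exists>cs. length cs = ?n \<and> knight_cycle cs \<and> Min (set cs) = 0 \<and>
    l = sorted_list_of_set (set cs) \<and> canonical_form (set cs) = l)" (is "_ \<longleftrightarrow> (\<exists>cs. ?P cs)") for l
  proof
    assume "l \<in> ?R"
    then obtain cs where cs: "l = sorted_list_of_set (set (0 # cs))" "length cs = Suc k"
      "completes [0] 0 cs" "least_image l nontrivial_symmetries"
      using set_search[of "[0]" 0 0 "Suc k"] by (auto simp: zero_prod_def)
    then have "knight_cycle (0 # cs)" "Min (set (0 # cs)) = 0"
      using knight_cycle_Cons_completes by blast+
    then have "?P (0 # cs)"
      using cs least_image_iff_canonical_form[of "set (0 # cs)"] by simp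
    then show "\<exists>cs. ?P cs" ..
  next
    assume "\<exists>cs. ?P cs"
    then obtain cs where cs: "?P cs" ..
    then have "set cs \<noteq> {}" by (auto simp: knight_cycle_def)
    then have "0 \<in> set cs" using Min_in[of "set cs"] cs by auto
    then obtain ds where ds: "knight_cycle ds" "set ds = set cs" "length ds = length cs" "hd ds = 0"
      using knight_cycle_start cs by metis
    then obtain es where es: "ds = 0 # es" by (cases ds) (auto simp: knight_cycle_def)
    then have "completes [0] 0 es" using knight_cycle_Cons_completes ds cs by metis
    moreover have "least_image (sorted_list_of_set (set ds)) nontrivial_symmetries"
      using least_image_iff_canonical_form[of "set cs"] ds cs \<open>set cs \<noteq> {}\<close> by simp
    moreover have "length es = Suc k" using ds es cs by simp
    ultimately have "sorted_list_of_set (set ds) \<in> ?R"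
      using set_search[of "[0]" 0 0 "Suc k"] es by (auto simp: zero_prod_def)
    then show "l \<in> ?R" using ds cs by simp
  qed
  have X: "S \<in> ?X \<longleftrightarrow> S \<subseteq> board (?n + 1) \<and> (\<exists>cs. length cs = ?n \<and> knight_cycle cs \<and> set cs = S)" for S
    by (rule closed_knight_paths_iff_knight_cycle) simp
  show ?thesis
  proof (intro equalityI subsetI)
    fix l assume "l \<in> canonical_form ` ?X"
    then obtain S where "S \<in> ?X" "l = canonical_form S" by blast
    then obtain cs where cs: "length cs = ?n" "knight_cycle cs" "l = canonical_form (set cs)"
      using iffD1[OF X] by blast
    have ne: "set cs \<noteq> {}" using cs by (auto simp: knight_cycle_def)
    obtain g where g: "g \<in> dihedral" "canonical_form (set cs) = sorted_form (g ` set cs)"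
      using canonical_form_attained by blast
    \<comment> \<open>The image attaining the minimum, moved so that its least cell is the origin,
      is again a cycle and is its own canonical form.\<close>
    define ds where "ds = map (\<lambda>c. - Min (g ` set cs) + g c) cs"
    have ds: "set ds = normal_form (g ` set cs)"
      by (simp add: ds_def normal_form_def image_image)
    have "knight_cycle ds" "length ds = ?n"
      using knight_cycle_affine[OF g(1) cs(2)] cs(1) by (simp_all only: ds_def length_map)
    moreover have "Min (set ds) = 0" unfolding ds using ne by (intro Min_normal_form) auto
    moreover have "l = sorted_list_of_set (set ds)" using cs g by (simp add: ds sorted_form_def)
    moreover have "canonical_form (set ds) = l"
      using canonical_form_affine[OF finite_set ne g(1)] cs(3) by (simp only: ds_def set_map)
    ultimately show "l \<in> ?R" unfolding search by blast
  next
    fix l assume "l \<in> ?R"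
    then obtain cs where cs: "length cs = ?n" "knight_cycle cs" "canonical_form (set cs) = l"
      unfolding search by blast
    obtain v where v: "(+) v ` set cs \<subseteq> board (?n + 1)"
      using knight_cycle_fits_on_board[OF cs(2)] cs(1) by auto
    have "(\<lambda>c. v + id c) ` set cs \<in> ?X"
      unfolding X using knight_cycle_affine[OF id_in_dihedral cs(2), of v] cs(1) v
      by (intro conjI exI[of _ "map (\<lambda>c. v + id c) cs"]) simp_all
    moreover have "canonical_form ((\<lambda>c. v + id c) ` set cs) = l"
      using canonical_form_affine[OF _ _ id_in_dihedral, of "set cs" v] cs
      by (simp add: knight_cycle_def)
    ultimately show "l \<in> canonical_form ` ?X" by blast
  qed
qed

text \<open>Classes correspond to values of the invariant, and the list of these values is strictly
  sorted, so its length counts them.\<close>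

lemma card_path_classes:
  "card (closed_knight_paths (Suc (Suc k) + 1) (Suc (Suc k)) // path_equiv (Suc (Suc k) + 1) (Suc (Suc k))) =
     length (search (Suc k) (2 * int (Suc k)) 0 0 [(0, 0)])"
proof -
  let ?n = "Suc (Suc k)"
  let ?X = "closed_knight_paths (?n + 1) ?n"
  have board: "S \<subseteq> board (?n + 1) \<and> S \<noteq> {}" if "S \<in> ?X" for S
    using that closed_knight_paths_iff_knight_cycle[of ?n S] by (auto simp: knight_cycle_def)
  have "card (?X // path_equiv (?n + 1) ?n) = card (canonical_form ` ?X)"
    using equiv_path_equiv
  proof (rule card_quotient_eq_card_image)
    fix S T assume "S \<in> ?X" "T \<in> ?X"
    then show "(S, T) \<in> path_equiv (?n + 1) ?n \<longleftrightarrow> canonical_form S = canonical_form T"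
      using elementary_steps_iff_canonical_form[of S "?n + 1" T] board
      by (simp add: path_equiv_def)
  qed
  also have "\<dots> = length (search (Suc k) (2 * int (Suc k)) 0 0 [0])"
    unfolding canonical_forms_eq_search
    by (intro distinct_card) (use sorted_search strict_sorted_iff in blast)
  finally show ?thesis by (simp only: zero_prod_def)
qed

text \<open>Seven cells remain after the origin, and the initial bound is
  \<open>14 = 2 * 7\<close>.\<close>

lemma length_search_8: "length (search 7 14 0 0 [(0, 0)]) = 478"
  by code_simp

theorem mainTheorem3:
  fixes n :: nat
  assumes "n = 8"
  shows "card (closed_knight_paths (n + 1) n // path_equiv (n + 1) n) = 478"
  \<comment> \<open>Here \<open>Suc (Suc 6) = 8\<close>.\<close>
  using card_path_classes[of 6] length_search_8 assms by simp

end
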